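(* Let $p$ be a prime and $q>p$ an integer. For $g\in\{0,\ldots,p-1\}$ let $s_g(t)$ be the CRT sequence of length $L=pq$ generated by $g$, and let $H_{g1}(\tau)=\sum_{t=0}^{L-1}s_g(t)s_1(t-\tau)$. (1) If $q=mp+1$ for an integer $m$, then for $g=2,3,\ldots,p-1$ and every $\tau$, $m-1\le H_{g1}(\tau)\le m+1$. (2) If $q=mp+(p-1)$ for an integer $m$, then for $g=2,3,\ldots,p-1$ and every $\tau$, $m\le H_{g1}(\tau)\le m+2$.
   Context: Sequences of length $L=pq$ are indexed by $\mathbb{Z}_L$, with $t-\tau$ computed modulo $L$. For $p$ prime and $q$ not divisible by $p$, put $G_{p,q}=\mathbb{Z}_p\oplus\mathbb{Z}_q$ and let $\Phi_{p,q}:\mathbb{Z}_{pq}\to G_{p,q}$, $\Phi_{p,q}(x)=(x \bmod p,\ x\bmod q)$. For $g\in\mathbb{Z}_p$ let $\mathcal{I}_{g,p,q}=\{(gt \bmod p,\ t)\in G_{p,q}: 0\le t<q\}$. The CRT sequence generated by $g$ is the binary sequence $s_g(t)$ of length $pq$ with $s_g(t)=1$ if $\Phi_{p,q}(t)\in\mathcal{I}_{g,p,q}$ and $s_g(t)=0$ otherwise. *)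

theory Defs
  imports "HOL-Number_Theory.Number_Theory"
begin

(* Elements of Z_n are represented by the residues 0, ..., n - 1 in int, so that the group
   Z_p + Z_q becomes the set of pairs in {0..<p} \<times> {0..<q}. *)

definition crt_map :: "int \<Rightarrow> int \<Rightarrow> int \<Rightarrow> int \<times> int" where
  "crt_map p q x = (x mod p, x mod q)"

definition crt_index_set :: "int \<Rightarrow> int \<Rightarrow> int \<Rightarrow> (int \<times> int) set" where
  "crt_index_set g p q = {((g * t) mod p, t) | t. 0 \<le> t \<and> t < q}"

definition crt_seq :: "int \<Rightarrow> int \<Rightarrow> int \<Rightarrow> int \<Rightarrow> int" where
  "crt_seq p q g t = (if crt_map p q t \<in> crt_index_set g p q then 1 else 0)"

definition crt_corr :: "int \<Rightarrow> int \<Rightarrow> int \<Rightarrow> int \<Rightarrow> int \<Rightarrow> int" where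
  "crt_corr p q g h \<tau> =
     (\<Sum>t\<in>{0..<p * q}. crt_seq p q g t * crt_seq p q h ((t - \<tau>) mod (p * q)))"

end

theory Submission
  imports Defs
begin

text \<open>
  A time t modulo pq contributes to the correlation exactly when x = t mod q satisfies a linear
  congruence modulo p with leading coefficient g - 1, since then t mod p is determined by x.
  The constant term of this congruence has one value for x < (\<tau> mod q) and another one for
  x \<ge> (\<tau> mod q), because (x - \<tau>) mod q wraps around.  On each of these two intervals a residue
  class modulo p has its expected number of elements up to an error of at most 1 - 1/p.  So p times
  the correlation differs from q by at most 2p - 2, and for q \<equiv> \<plusminus>1 modulo p integrality of the
  correlation yields the bounds.
\<close>

lemma le_div_iff_mult_le_int:
  fixes j n p :: int
  assumes "p > 0"
  shows "j \<le> n div p \<longleftrightarrow> p * j \<le> n"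
proof
  assume "j \<le> n div p"
  then have "p * j \<le> p * (n div p)" using assms by simp
  also have "\<dots> \<le> n" using assms by (simp flip: minus_mod_eq_mult_div)
  finally show "p * j \<le> n" .
next
  assume "p * j \<le> n"
  from zdiv_mono1[OF this assms] show "j \<le> n div p" using assms by simp
qed

text \<open>Writing the members of the class as \<open>u - p * j\<close> turns the count into a
  difference of two floor quotients. Multiplied by \<open>p\<close>, its deviation from
  \<open>b - a\<close> is a difference of two remainders in \<open>{0..<p}\<close>.\<close>

lemma card_residue_class_interval:
  fixes a b p u :: int
  assumes "p > 0" "a \<le> b"
  shows "\<bar>p * int (card {x \<in> {a..<b}. [x = u] (mod p)}) - (b - a)\<bar> \<le> p - 1"
proof -
  \<comment> \<open>The map from \<open>j\<close> to \<open>u - p * j\<close> reverses order, so the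
    open end at \<open>b\<close> becomes the open left end of the \<open>j\<close> interval.\<close>
  have mem_J: "j \<in> {(u - b) div p<..(u - a) div p} \<longleftrightarrow> u - p * j \<in> {a..<b}" for j
    using le_div_iff_mult_le_int[OF assms(1), of j "u - a"]
      le_div_iff_mult_le_int[OF assms(1), of j "u - b"]
    unfolding greaterThanAtMost_iff atLeastLessThan_iff by linarith
  have "{x \<in> {a..<b}. [x = u] (mod p)}
        = (\<lambda>j. u - p * j) ` {(u - b) div p<..(u - a) div p}" (is "?A = ?f ` ?J")
  proof (intro equalityI subsetI)
    fix x assume x: "x \<in> ?A"
    then have "[u = x] (mod p)" by (blast intro: cong_sym)
    then have "p dvd u - x" by (simp add: cong_iff_dvd_diff)
    then obtain j where "u - x = p * j" by blast
    then have "x = ?f j" by simp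
    with x show "x \<in> ?f ` ?J" using mem_J[of j] by blast
  next
    fix x assume "x \<in> ?f ` ?J"
    then obtain j where "x = ?f j" "j \<in> ?J" by blast
    then show "x \<in> ?A" using mem_J[of j] by (simp add: cong_iff_dvd_diff)
  qed
  moreover have "inj_on ?f ?J" using assms by (auto simp: inj_on_def)
  \<comment> \<open>This ordering keeps the truncated \<open>nat\<close> in the cardinality of the
    \<open>j\<close> interval exact.\<close>
  moreover have "(u - b) div p \<le> (u - a) div p" using assms by (intro zdiv_mono1) auto
  ultimately have "int (card ?A) = (u - a) div p - (u - b) div p"
    by (simp add: card_image)
  then have "p * int (card ?A) - (b - a) = (u - b) mod p - (u - a) mod p"
    by (simp add: right_diff_distrib minus_mod_eq_mult_div [symmetric])
  moreover have "0 \<le> (u - b) mod p" "(u - b) mod p < p" "0 \<le> (u - a) mod p" "(u - a) mod p < p"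
    using assms by auto
  ultimately show ?thesis by linarith
qed

text \<open>An inverse of \<open>d\<close> modulo \<open>p\<close> turns the linear congruence into
  a single residue class.\<close>

lemma card_linear_cong_interval:
  fixes a b c d p :: int
  assumes "p > 0" "coprime d p" "a \<le> b"
  shows "\<bar>p * int (card {x \<in> {a..<b}. [d * x = c] (mod p)}) - (b - a)\<bar> \<le> p - 1"
proof -
  obtain e where e: "[d * e = 1] (mod p)" using cong_solve_coprime_int assms(2) by blast
  have "[d * x = c] (mod p) \<longleftrightarrow> [x = e * c] (mod p)" for x
  proof -
    have "[d * (e * c) = c] (mod p)" using cong_scalar_right[OF e, of c] by (simp add: mult.assoc)
    then have "[d * x = c] (mod p) \<longleftrightarrow> [d * x = d * (e * c)] (mod p)"
      by (metis cong_sym cong_trans)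
    then show ?thesis using assms(2) by (simp add: cong_mult_lcancel)
  qed
  then show ?thesis using card_residue_class_interval[OF assms(1,3), of "e * c"] by simp
qed

text \<open>The second coordinate forces the parameter of the index set to be
  \<open>t mod q\<close>, so only the first coordinate is left to test.\<close>

lemma crt_seq_eq_of_bool:
  assumes "q > 0"
  shows "crt_seq p q g t = of_bool ([t = g * (t mod q)] (mod p))"
  using assms by (auto simp: crt_seq_def crt_map_def crt_index_set_def cong_def)

lemma crt_corr_eq_card:
  fixes p q g h \<tau> :: int
  assumes "p > 0" "q > 0" "coprime p q"
  shows "crt_corr p q g h \<tau>
         = int (card {x \<in> {0..<q}. [g * x - \<tau> = h * ((x - \<tau>) mod q)] (mod p)})"
    (is "_ = int (card ?B)")
proof -
  let ?A = "{t \<in> {0..<p * q}. [t = g * (t mod q)] (mod p) \<and> [t - \<tau> = h * ((t - \<tau>) mod q)] (mod p)}"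
  \<comment> \<open>Reduction modulo \<open>p * q\<close> changes neither the residue modulo
    \<open>p\<close> nor the one modulo \<open>q\<close>.\<close>
  have "crt_seq p q g t * crt_seq p q h ((t - \<tau>) mod (p * q))
        = of_bool ([t = g * (t mod q)] (mod p) \<and> [t - \<tau> = h * ((t - \<tau>) mod q)] (mod p))" for t
    using assms by (simp add: crt_seq_eq_of_bool cong_def mod_mod_cancel)
  then have "crt_corr p q g h \<tau> = (\<Sum>t\<in>{0..<p * q}.
      of_bool ([t = g * (t mod q)] (mod p) \<and> [t - \<tau> = h * ((t - \<tau>) mod q)] (mod p)))"
    unfolding crt_corr_def by simp
  also have "\<dots> = int (card ?A)"
    by (simp add: Int_def)
  also have "card ?A = card ?B"
  \<comment> \<open>The bijection sends \<open>t\<close> to \<open>t mod q\<close>. Its inverse is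
    the Chinese remainder solution of t \<equiv> g x modulo \<open>p\<close> and t \<equiv> x modulo
    \<open>q\<close>.\<close>
  proof (rule bij_betw_same_card, rule bij_betwI')
    fix s t assume "s \<in> ?A" "t \<in> ?A"
    then show "s mod q = t mod q \<longleftrightarrow> s = t"
    proof safe
      assume st: "[s = g * (s mod q)] (mod p)" "[t = g * (t mod q)] (mod p)" "s mod q = t mod q"
        and range: "s \<in> {0..<p * q}" "t \<in> {0..<p * q}"
      have "[s = t] (mod p)" using st by (metis cong_sym cong_trans)
      moreover have "[s = t] (mod q)" using st by (simp add: cong_def)
      ultimately have "[s = t] (mod (p * q))"
        using assms by (simp add: coprime_cong_mult)
      then show "s = t" using range by (auto intro: cong_less_imp_eq_int)
    qed
  next
    fix t assume t: "t \<in> ?A"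
    have "[g * (t mod q) - \<tau> = t - \<tau>] (mod p)"
      using t by (auto intro!: cong_diff simp: cong_sym_eq)
    also have "[t - \<tau> = h * ((t mod q - \<tau>) mod q)] (mod p)"
      using t by (simp add: mod_diff_left_eq)
    finally show "t mod q \<in> ?B" using assms by simp
  next
    fix x assume x: "x \<in> ?B"
    obtain t0 where t0: "[t0 = g * x] (mod p)" "[t0 = x] (mod q)"
      using binary_chinese_remainder_int[OF assms(3)] by blast
    define t where "t = t0 mod (p * q)"
    have t: "[t = g * x] (mod p)" "t mod q = x"
      using t0 x by (auto simp: t_def cong_def mod_mod_cancel)
    have "[t - \<tau> = g * x - \<tau>] (mod p)"
      using t by (intro cong_diff) auto
    also have "[g * x - \<tau> = h * ((t - \<tau>) mod q)] (mod p)"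
      using x t(2) by (metis (no_types, lifting) mem_Collect_eq mod_diff_left_eq)
    finally have "t \<in> ?A" using t assms by (auto simp: t_def)
    then show "\<exists>t\<in>?A. x = t mod q" using t by blast
  qed
  finally show ?thesis .
qed

lemma crt_corr_approx:
  fixes p q g h \<tau> :: int
  assumes "p > 0" "q > 0" "coprime p q" "coprime (g - h) p"
  shows "\<bar>p * crt_corr p q g h \<tau> - q\<bar> \<le> 2 * p - 2"
proof -
  define b where "b = \<tau> mod q"
  have b: "0 \<le> b" "b < q" using assms by (auto simp: b_def)
  \<comment> \<open>Below \<open>b\<close> the shifted index is \<open>x - b + q\<close>, from
    \<open>b\<close> on it is \<open>x - b\<close>. Substituting each and collecting the multiples
    of \<open>x\<close> gives the two right-hand sides.\<close>
  define X where "X = {x \<in> {0..<b}. [(g - h) * x = \<tau> - h * b + h * q] (mod p)}"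
  define Y where "Y = {x \<in> {b..<q}. [(g - h) * x = \<tau> - h * b] (mod p)}"
  have shift: "(x - \<tau>) mod q = (if x < b then x - b + q else x - b)" if "0 \<le> x" "x < q" for x
  proof -
    have "(x - \<tau>) mod q = (x - b) mod q" by (simp add: b_def mod_diff_right_eq)
    also have "\<dots> = (if x < b then x - b + q else x - b)"
    proof (cases "x < b")
      case True
      have "(x - b) mod q = (x - b + q) mod q" by simp
      also have "\<dots> = x - b + q" using True that b by (intro mod_pos_pos_trivial) auto
      finally show ?thesis using True by simp
    next
      case False
      then show ?thesis using that b by (simp add: mod_pos_pos_trivial)
    qed
    finally show ?thesis .
  qed
  have mem: "[g * x - \<tau> = h * ((x - \<tau>) mod q)] (mod p) \<longleftrightarrow> x \<in> X \<union> Y"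
    if x: "0 \<le> x" "x < q" for x
  proof (cases "x < b")
    case True
    then have eq: "(x - \<tau>) mod q = x - b + q" using shift[OF x] by simp
    have diff: "g * x - \<tau> - h * ((x - \<tau>) mod q) = (g - h) * x - (\<tau> - h * b + h * q)"
      unfolding eq by (simp add: algebra_simps)
    show ?thesis
      using x True unfolding X_def Y_def cong_iff_dvd_diff diff by simp
  next
    case False
    then have eq: "(x - \<tau>) mod q = x - b" using shift[OF x] by simp
    have diff: "g * x - \<tau> - h * ((x - \<tau>) mod q) = (g - h) * x - (\<tau> - h * b)"
      unfolding eq by (simp add: algebra_simps)
    show ?thesis
      using x False unfolding X_def Y_def cong_iff_dvd_diff diff by simp
  qed
  have "X \<union> Y \<subseteq> {0..<q}" using b by (auto simp: X_def Y_def)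
  then have "{x \<in> {0..<q}. [g * x - \<tau> = h * ((x - \<tau>) mod q)] (mod p)} = X \<union> Y"
    by (intro equalityI subsetI) (use mem in \<open>auto simp del: Un_iff\<close>)
  moreover have "X \<inter> Y = {}" by (auto simp: X_def Y_def)
  moreover have "finite X" "finite Y" unfolding X_def Y_def by (rule finite_Collect_conjI, simp)+
  ultimately have "crt_corr p q g h \<tau> = int (card X) + int (card Y)"
    using crt_corr_eq_card[OF assms(1-3)] by (simp add: card_Un_disjoint)
  then have "p * crt_corr p q g h \<tau> - q
             = (p * int (card X) - (b - 0)) + (p * int (card Y) - (q - b))"
    by (simp add: distrib_left)
  moreover have "\<bar>p * int (card X) - (b - 0)\<bar> \<le> p - 1" "\<bar>p * int (card Y) - (q - b)\<bar> \<le> p - 1"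
    unfolding X_def Y_def using assms b by (intro card_linear_cong_interval; simp)+
  ultimately show ?thesis by linarith
qed

theorem theorem5:
  fixes p q :: int
  assumes "prime p" and "q > p"
  shows "(\<forall>m. q = m * p + 1 \<longrightarrow>
            (\<forall>g\<in>{2..p - 1}. \<forall>\<tau>. m - 1 \<le> crt_corr p q g 1 \<tau> \<and> crt_corr p q g 1 \<tau> \<le> m + 1)) \<and>
         (\<forall>m. q = m * p + (p - 1) \<longrightarrow>
            (\<forall>g\<in>{2..p - 1}. \<forall>\<tau>. m \<le> crt_corr p q g 1 \<tau> \<and> crt_corr p q g 1 \<tau> \<le> m + 2))"
proof -
  have p: "p > 0" using assms by (simp add: prime_gt_0_int)
  have approx: "\<bar>p * crt_corr p q g 1 \<tau> - q\<bar> \<le> 2 * p - 2"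
    if "g \<in> {2..p - 1}" "\<not> p dvd q" for g \<tau>
  proof (rule crt_corr_approx)
    \<comment> \<open>The number \<open>g - 1\<close> lies strictly between 0 and \<open>p\<close>;
      this is where \<open>g = 0\<close> and \<open>g = 1\<close> are excluded.\<close>
    have "\<not> p dvd g - 1" using that by (auto dest: zdvd_imp_le)
    then show "coprime (g - 1) p" using assms by (simp add: prime_imp_coprime coprime_commute)
    show "coprime p q" using that assms by (simp add: prime_imp_coprime)
  qed (use p assms in auto)
  have sandwich: "k < n \<and> n < l" if "p * k < p * n" "p * n < p * l" for k n l
    using that p by (simp add: mult_less_cancel_left_pos)
  show ?thesis
  proof (intro conjI allI impI ballI)
    fix m g \<tau> assume q: "q = m * p + 1" and g: "g \<in> {2..p - 1}"
    \<comment> \<open>A \<open>g\<close> in the range exists only if \<open>p\<close> is at least 3,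
      so \<open>p\<close> does not divide 1.\<close>
    have "\<not> p dvd q" using q g by (simp add: dvd_add_right_iff)
    from approx[OF g this, of \<tau>]
    \<comment> \<open>The bounds are \<open>p * (m - 2) + 3\<close> and
      \<open>p * (m + 2) - 1\<close>: the error \<open>2 * p - 2\<close> just suffices for
      strictness above.\<close>
    have "p * (m - 2) < p * crt_corr p q g 1 \<tau>" "p * crt_corr p q g 1 \<tau> < p * (m + 2)"
      using q g by (auto simp: algebra_simps)
    from sandwich[OF this]
    show "m - 1 \<le> crt_corr p q g 1 \<tau>" "crt_corr p q g 1 \<tau> \<le> m + 1" by auto
  next
    fix m g \<tau> assume q: "q = m * p + (p - 1)" and g: "g \<in> {2..p - 1}"
    have "q = (m + 1) * p - 1" using q by (simp add: algebra_simps)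
    then have "\<not> p dvd q" using g by (simp add: dvd_diff_right_iff)
    from approx[OF g this, of \<tau>]
    \<comment> \<open>Here the bounds are \<open>p * (m - 1) + 1\<close> and
      \<open>p * (m + 3) - 3\<close>, so the tight side is the lower one.\<close>
    have "p * (m - 1) < p * crt_corr p q g 1 \<tau>" "p * crt_corr p q g 1 \<tau> < p * (m + 3)"
      unfolding q abs_le_iff using g by (auto simp: algebra_simps)
    from sandwich[OF this]
    show "m \<le> crt_corr p q g 1 \<tau>" "crt_corr p q g 1 \<tau> \<le> m + 2" by auto
  qed
qed

end
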